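(* Let $\vec U$ be a finite universe of separations and let $\vec U'=[x,x^*]\subseteq\vec U$ be a (non-empty) symmetric interval in $\vec U$. Suppose that $f\colon\vec U'\to\mathbb R_{\ge0}$ is a submodular order function on $\vec U'$ with maximum value $k$. Then there exists a submodular order function $g\colon\vec U\to\mathbb R_{\ge0}$ such that $g(z)=f(z)$ for all $z\in\vec U'$ and $g(z)>k$ for all $z\in\vec U\setminus\vec U'$.
   Context: A universe of separations is a lattice $\vec U$ equipped with an order-reversing involution ${}^*$. For $x\in\vec U$, $[x,x^*]=\{s\in\vec U\mid x\le s\le x^*\}$; it is closed under ${}^*$, joins and meets, hence itself a universe with the restricted structure. A submodular order function on a universe $\vec W$ is a function $f\colon\vec W\to\mathbb R_{\ge0}$ with $f(r\vee s)+f(r\wedge s)\le f(r)+f(s)$ for all $r,s\in\vec W$ and $f(s)=f(s^* )$ for all $s\in\vec W$. *)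

theory Defs
  imports Complex_Main
begin

locale universe_of_separations =
  fixes star :: "'a::lattice \<Rightarrow> 'a"
  assumes star_star: "star (star s) = s"
    and star_antimono: "r \<le> s \<Longrightarrow> star s \<le> star r"

definition symmetric_interval :: "('a::lattice \<Rightarrow> 'a) \<Rightarrow> 'a \<Rightarrow> 'a set" where
  "symmetric_interval star x = {x..star x}"

(* W is the carrier of a sub-universe: the ambient type itself or a symmetric interval.
   Both are closed under star, join and meet (lemmas below), so the join and meet of W are
   the ambient ones. Values of f outside W are irrelevant. *)
definition submodular_order_function ::
    "('a::lattice \<Rightarrow> 'a) \<Rightarrow> 'a set \<Rightarrow> ('a \<Rightarrow> real) \<Rightarrow> bool" where
  "submodular_order_function star W f \<longleftrightarrow>
     (\<forall>s\<in>W. 0 \<le> f s) \<and>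
     (\<forall>r\<in>W. \<forall>s\<in>W. f (sup r s) + f (inf r s) \<le> f r + f s) \<and>
     (\<forall>s\<in>W. f s = f (star s))"

context universe_of_separations
begin

lemma symmetric_interval_star:
  "s \<in> symmetric_interval star x \<Longrightarrow> star s \<in> symmetric_interval star x"
  unfolding symmetric_interval_def using star_antimono star_star by (metis atLeastAtMost_iff)

lemma symmetric_interval_sup:
  "r \<in> symmetric_interval star x \<Longrightarrow> s \<in> symmetric_interval star x
    \<Longrightarrow> sup r s \<in> symmetric_interval star x"
  unfolding symmetric_interval_def by (auto intro: le_supI1)

lemma symmetric_interval_inf:
  "r \<in> symmetric_interval star x \<Longrightarrow> s \<in> symmetric_interval star x
    \<Longrightarrow> inf r s \<in> symmetric_interval star x"
  unfolding symmetric_interval_def by (auto intro: le_infI1)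

end

end

theory Submission
  imports Defs
begin

text \<open>
  A finite lattice carries a function \<open>a \<ge> 0\<close> that vanishes exactly above \<open>x\<close> and is strictly
  submodular on every incomparable pair not lying entirely above \<open>x\<close>: away from the up-set of
  \<open>x\<close>, take a large constant minus two to the number of elements not below \<open>z\<close>, which is
  increasing and so concave that the loss at the meet dominates. Then \<open>h z = a z + a (star z)\<close>
  is symmetric, vanishes exactly on the interval, and is strictly submodular on every
  incomparable pair not contained in it. Extending \<open>f\<close> by the constant \<open>k\<close> destroys
  submodularity by at most \<open>2 * k\<close>, and a large multiple of \<open>h\<close> repairs this.
\<close>

definition not_below :: "'a::order \<Rightarrow> 'a set" where
  "not_below z = {y. \<not> y \<le> z}"

text \<open>Since \<open>not_below z\<close> has at most \<open>card UNIV\<close> elements, the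
  constant \<open>1 + 2 ^ card UNIV\<close> keeps every value outside the up-set of \<open>x\<close>
  at least 1.\<close>

definition penalty :: "'a::order \<Rightarrow> 'a \<Rightarrow> real" where
  "penalty x z = (if x \<le> z then 0
     else 1 + 2 ^ card (UNIV :: 'a set) - 2 ^ card (not_below z))"

lemma two_power_not_below_le:
  fixes z :: "'a::order"
  assumes "finite (UNIV :: 'a set)"
  shows "(2::real) ^ card (not_below z) \<le> 2 ^ card (UNIV :: 'a set)"
  using card_mono[OF assms subset_UNIV[of "not_below z"]] by simp

lemma penalty_ge_1:
  fixes x z :: "'a::order"
  assumes "finite (UNIV :: 'a set)" and "\<not> x \<le> z"
  shows "1 \<le> penalty x z"
proof -
  have "penalty x z = 1 + 2 ^ card (UNIV :: 'a set) - 2 ^ card (not_below z)"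
    using assms(2) by (simp add: penalty_def)
  then show ?thesis
    using two_power_not_below_le[OF assms(1), of z] by linarith
qed

lemma penalty_nonneg:
  fixes x z :: "'a::order"
  assumes "finite (UNIV :: 'a set)"
  shows "0 \<le> penalty x z"
proof (cases "x \<le> z")
  case False
  then show ?thesis using penalty_ge_1[OF assms] by fastforce
qed (simp add: penalty_def)

text \<open>The element \<open>s\<close> itself witnesses that \<open>not_below\<close> shrinks
  strictly from \<open>r\<close> to \<open>s\<close>, so the exponent drops by at least one.\<close>

lemma two_power_not_below_less:
  fixes r s :: "'a::order"
  assumes "finite (UNIV :: 'a set)" and "r < s"
  shows "2 * 2 ^ card (not_below s) \<le> (2::real) ^ card (not_below r)"
proof -
  have "not_below s \<subset> not_below r"
    using assms(2) by (force simp: not_below_def)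
  then have "card (not_below s) < card (not_below r)"
    by (rule psubset_card_mono[OF finite_subset[OF subset_UNIV assms(1)]])
  then have "(2::real) ^ Suc (card (not_below s)) \<le> 2 ^ card (not_below r)"
    by (intro power_increasing) auto
  then show ?thesis by simp
qed

text \<open>The meet lies strictly below both \<open>r\<close> and \<open>s\<close>, so its power of
  two is at least twice each of theirs and hence at least their sum. The gap 1 comes from a further
  power, which is at least 1.\<close>

lemma penalty_strictly_submodular:
  fixes x r s :: "'a::lattice"
  assumes fin: "finite (UNIV :: 'a set)"
    and inc: "\<not> r \<le> s" "\<not> s \<le> r"
    and out: "\<not> (x \<le> r \<and> x \<le> s)"
  shows "penalty x (sup r s) + penalty x (inf r s) + 1 \<le> penalty x r + penalty x s"
proof -
  have "inf r s < r" "inf r s < s"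
    using inc by (auto simp: less_le_not_le)
  then have le: "2 * 2 ^ card (not_below r) \<le> (2::real) ^ card (not_below (inf r s))"
    "2 * 2 ^ card (not_below s) \<le> (2::real) ^ card (not_below (inf r s))"
    using fin by (auto intro: two_power_not_below_less)
  have ge: "(1::real) \<le> 2 ^ card (not_below z)" for z :: 'a
    by simp
  consider "x \<le> r" "\<not> x \<le> s" | "\<not> x \<le> r" "x \<le> s" | "\<not> x \<le> r" "\<not> x \<le> s"
    using out by blast
  then show ?thesis
  proof cases
    \<comment> \<open>Only the penalties of \<open>s\<close> and \<open>inf r s\<close> survive;
      doubling leaves a margin of \<open>2 ^ card (not_below s)\<close>.\<close>
    case 1
    then have "x \<le> sup r s" by (simp add: le_supI1)
    then show ?thesis using 1 by (simp add: penalty_def) (use le ge[of s] in linarith)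
  next
    case 2
    then have "x \<le> sup r s" by (simp add: le_supI2)
    then show ?thesis using 2 by (simp add: penalty_def) (use le ge[of r] in linarith)
  next
    case 3
    then have "penalty x r = 1 + 2 ^ card (UNIV :: 'a set) - 2 ^ card (not_below r)"
      "penalty x s = 1 + 2 ^ card (UNIV :: 'a set) - 2 ^ card (not_below s)"
      "penalty x (inf r s) = 1 + 2 ^ card (UNIV :: 'a set) - 2 ^ card (not_below (inf r s))"
      by (simp_all add: penalty_def)
    \<comment> \<open>The join may enter the up-set of \<open>x\<close>; its penalty 0 is then still
      below the formula for the other case.\<close>
    moreover have
      "penalty x (sup r s) \<le> 1 + 2 ^ card (UNIV :: 'a set) - 2 ^ card (not_below (sup r s))"
    proof (cases "x \<le> sup r s")
      case True
      then have "penalty x (sup r s) = 0"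
        by (simp add: penalty_def)
      then show ?thesis
        using two_power_not_below_le[OF fin, of "sup r s"] by linarith
    qed (simp add: penalty_def)
    ultimately show ?thesis
      using le ge[of "sup r s"] by linarith
  qed
qed

lemma penalty_submodular:
  fixes x r s :: "'a::lattice"
  assumes fin: "finite (UNIV :: 'a set)"
  shows "penalty x (sup r s) + penalty x (inf r s) \<le> penalty x r + penalty x s"
proof -
  consider "r \<le> s" | "s \<le> r" | "x \<le> r" "x \<le> s"
    | "\<not> r \<le> s" "\<not> s \<le> r" "\<not> (x \<le> r \<and> x \<le> s)"
    by blast
  then show ?thesis
  proof cases
    case 3
    then show ?thesis by (simp add: penalty_def le_supI1)
  next
    case 4
    then show ?thesis using penalty_strictly_submodular[OF fin] by fastforce
  qed (simp_all add: sup_absorb1 sup_absorb2 inf_absorb1 inf_absorb2)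
qed

context universe_of_separations
begin

lemma star_le_star_iff: "star r \<le> star s \<longleftrightarrow> s \<le> r"
  using star_antimono star_star by metis

lemma le_star_iff: "r \<le> star s \<longleftrightarrow> s \<le> star r"
  using star_antimono star_star by metis

lemma star_sup: "star (sup r s) = inf (star r) (star s)"
proof (rule order.antisym)
  show "inf (star r) (star s) \<le> star (sup r s)"
    using le_star_iff by (metis inf_le1 inf_le2 sup_least)
qed (auto intro: star_antimono)

lemma star_inf: "star (inf r s) = sup (star r) (star s)"
  using star_sup star_star by metis

text \<open>In this form the interval is exactly where both summands of \<open>h\<close>
  vanish.\<close>

lemma mem_symmetric_interval_iff: "z \<in> symmetric_interval star x \<longleftrightarrow> x \<le> z \<and> x \<le> star z"
  unfolding symmetric_interval_def using le_star_iff by auto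

lemma star_mem_symmetric_interval_iff:
  "star z \<in> symmetric_interval star x \<longleftrightarrow> z \<in> symmetric_interval star x"
  by (auto simp: mem_symmetric_interval_iff star_star)

end

theorem theorem5p5:
  fixes star :: "'a::lattice \<Rightarrow> 'a" and x :: 'a and f :: "'a \<Rightarrow> real" and k :: real
  assumes "universe_of_separations star"
    and "finite (UNIV :: 'a set)"
    and "symmetric_interval star x \<noteq> {}"
    and "submodular_order_function star (symmetric_interval star x) f"
    and "k = Max (f ` symmetric_interval star x)"
  shows "\<exists>g :: 'a \<Rightarrow> real. submodular_order_function star UNIV g \<and>
           (\<forall>z \<in> symmetric_interval star x. g z = f z) \<and>
           (\<forall>z \<in> UNIV - symmetric_interval star x. g z > k)"
proof -
  interpret universe_of_separations star by fact
  let ?I = "symmetric_interval star x"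
  note fin = assms(2)
  have f_nonneg: "0 \<le> f s" if "s \<in> ?I" for s
    using assms(4) that unfolding submodular_order_function_def by blast
  have f_sub: "f (sup r s) + f (inf r s) \<le> f r + f s" if "r \<in> ?I" "s \<in> ?I" for r s
    using assms(4) that unfolding submodular_order_function_def by blast
  have f_star: "f (star s) = f s" if "s \<in> ?I" for s
    using assms(4) that unfolding submodular_order_function_def by metis
  have f_le: "f s \<le> k" if "s \<in> ?I" for s
    unfolding assms(5) by (rule Max_ge) (use that finite_subset[OF subset_UNIV fin] in auto)
  have k_nonneg: "0 \<le> k"
    using assms(3) f_nonneg f_le by (meson ex_in_conv order_trans)

  define F where "F z = (if z \<in> ?I then f z else k)" for z
  define h where "h z = penalty x z + penalty x (star z)" for z
  \<comment> \<open>The part \<open>2 * k\<close> of the factor pays for the submodularity defect of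
    \<open>F\<close>, whose values lie between 0 and \<open>k\<close>; the extra 1 keeps the factor
    positive when \<open>k = 0\<close>, so that \<open>g\<close> exceeds \<open>k\<close> off the
    interval.\<close>
  define g where "g z = F z + (2 * k + 1) * h z" for z

  have F_bounds: "0 \<le> F z" "F z \<le> k" for z
    using f_nonneg f_le k_nonneg by (auto simp: F_def)
  have h_zero: "h z = 0" if "z \<in> ?I" for z
    using that by (simp add: h_def penalty_def mem_symmetric_interval_iff)
  have h_nonneg: "0 \<le> h z" for z
    by (simp add: h_def penalty_nonneg[OF fin])
  have h_ge_1: "1 \<le> h z" if "z \<notin> ?I" for z
    using that penalty_ge_1[OF fin, of x z] penalty_ge_1[OF fin, of x "star z"]
      penalty_nonneg[OF fin, of x z] penalty_nonneg[OF fin, of x "star z"]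
    unfolding h_def mem_symmetric_interval_iff by linarith
  have h_strict: "h (sup r s) + h (inf r s) + 1 \<le> h r + h s"
    if "\<not> r \<le> s" "\<not> s \<le> r" "\<not> (r \<in> ?I \<and> s \<in> ?I)" for r s
  proof -
    \<comment> \<open>At least one of the two summands of \<open>h\<close> is strict on this pair,
      and the other is still submodular; \<open>star\<close> merely swaps join and meet.\<close>
    have "\<not> (x \<le> r \<and> x \<le> s) \<or> \<not> (x \<le> star r \<and> x \<le> star s)"
      using that(3) by (auto simp: mem_symmetric_interval_iff)
    moreover have "\<not> star r \<le> star s" "\<not> star s \<le> star r"
      using that(1,2) by (simp_all add: star_le_star_iff)
    ultimately show ?thesis
      using penalty_strictly_submodular[OF fin that(1,2), of x]
        penalty_strictly_submodular[OF fin, of "star r" "star s" x]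
        penalty_submodular[OF fin, of x r s] penalty_submodular[OF fin, of x "star r" "star s"]
      unfolding h_def star_sup star_inf by linarith
  qed

  have g_nonneg: "0 \<le> g z" for z
    using F_bounds h_nonneg k_nonneg by (simp add: g_def)
  have g_sub: "g (sup r s) + g (inf r s) \<le> g r + g s" for r s
  proof -
    consider "r \<le> s" | "s \<le> r" | "r \<in> ?I" "s \<in> ?I"
      | "\<not> r \<le> s" "\<not> s \<le> r" "\<not> (r \<in> ?I \<and> s \<in> ?I)"
      by blast
    then show ?thesis
    proof cases
      case 3
      then show ?thesis
        by (simp add: g_def F_def h_zero f_sub symmetric_interval_sup symmetric_interval_inf)
    next
      case 4
      \<comment> \<open>The gap 1 of \<open>h\<close> becomes \<open>2 * k + 1\<close>, more than
        \<open>F (sup r s) + F (inf r s)\<close> can amount to.\<close>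
      then have "(2 * k + 1) * (h (sup r s) + h (inf r s) + 1) \<le> (2 * k + 1) * (h r + h s)"
        using k_nonneg by (intro mult_left_mono h_strict) auto
      then show ?thesis
        using F_bounds[of r] F_bounds[of s] F_bounds[of "sup r s"] F_bounds[of "inf r s"]
        unfolding g_def distrib_left mult_1_right by linarith
    qed (simp_all add: sup_absorb1 sup_absorb2 inf_absorb1 inf_absorb2)
  qed
  have g_star: "g z = g (star z)" for z
    by (simp add: g_def F_def h_def star_star star_mem_symmetric_interval_iff f_star)
  have g_gt: "k < g z" if "z \<notin> ?I" for z
  proof -
    have "(2 * k + 1) * 1 \<le> (2 * k + 1) * h z"
      using k_nonneg h_ge_1[OF that] by (intro mult_left_mono) auto
    then show ?thesis using that k_nonneg by (simp add: g_def F_def)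
  qed
  show ?thesis
  proof (intro exI[of _ g] conjI ballI)
    show "submodular_order_function star UNIV g"
      unfolding submodular_order_function_def using g_nonneg g_sub g_star by blast
    show "g z = f z" if "z \<in> ?I" for z
      using that by (simp add: g_def F_def h_zero)
  qed (use g_gt in blast)
qed

end
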